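(* Suppose that $f(z)=h(z)+\overline{g(z)}=\sum_{n=0}^{\infty}a_n z^n+\overline{\sum_{n=2}^{\infty}b_n z^n}$ is a sense-preserving harmonic mapping in $\mathbb{D}$ and $h\prec \varphi$, where $\varphi$ is analytic, univalent and convex in $\mathbb{D}$. Then $$\sum_{n=1}^{\infty}|a_n|r^n+\sum_{n=2}^{\infty}|b_n|r^n\leq \operatorname{dist}(\varphi(0),\partial\varphi(\mathbb{D}))$$ for $|z|=r\leq r_c= 0.294265\cdots$, where $r_c$ is the positive root (in $(0,1)$) of the equation $$\frac{r}{1-r}+\frac{r^2}{1-r^2}\sqrt{\left(\frac{1+r^2}{1-r^2}\right)\left(\frac{\pi^2}{6}-1\right)}=\frac{1}{2}.$$ Moreover, the number $r_c=0.294265\cdots$ cannot be replaced by a number greater than $R=0.299823\cdots$, where $R$ is the positive root (in $(0,1)$) of the equation $$\frac{4 R}{1-R}+2\log(1-R)=1;$$ that is, for every $\rho\in(R,1)$ there exist $f$ and $\varphi$ satisfying the hypotheses for which the inequality fails for some $r\le\rho$.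
   Context: $\mathbb{D}=\{z\in\mathbb{C}:|z|<1\}$. A harmonic mapping $f$ in $\mathbb{D}$ is a complex-valued function whose real and imaginary parts are harmonic; it is written $f=h+\overline{g}$ with $h,g$ analytic in $\mathbb{D}$ and $g(0)=0$, with power series coefficients $a_n$ of $h$ and $b_n$ of $g$ (here $b_1=0$). A locally univalent harmonic mapping $f=h+\overline{g}$ is sense-preserving if $|h'(z)|^2-|g'(z)|^2>0$ in $\mathbb{D}$ (equivalently, the dilatation $\omega=g'/h'$ is analytic and maps $\mathbb{D}$ into itself). For analytic $h,\varphi$ in $\mathbb{D}$ with $h(0)=\varphi(0)$, $h\prec\varphi$ ($h$ is subordinate to $\varphi$) means $h(z)=\varphi(w(z))$ for some analytic $w$ on $\mathbb{D}$ with $|w(z)|\le|z|$. A univalent $\varphi$ is convex if $\varphi(\mathbb{D})$ is a convex domain. $\operatorname{dist}(\varphi(0),\partial\varphi(\mathbb{D}))$ is the Euclidean distance from $\varphi(0)$ to the boundary of $\varphi(\mathbb{D})$. *)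

theory Defs
  imports "HOL-Complex_Analysis.Complex_Analysis"
begin

abbreviation unit_disc :: "complex set" where
  "unit_disc \<equiv> ball 0 1"

text \<open>Partial derivatives, in the directions 1 and \<open>\<i>\<close>, of a real-valued function of
  \<open>x + \<i> y\<close>. They are only meaningful where \<open>u\<close> is differentiable, which
  \<open>C1_on\<close> demands explicitly.\<close>

definition partial_x :: "(complex \<Rightarrow> real) \<Rightarrow> complex \<Rightarrow> real" where
  "partial_x u z = deriv (\<lambda>t::real. u (z + of_real t)) 0"

definition partial_y :: "(complex \<Rightarrow> real) \<Rightarrow> complex \<Rightarrow> real" where
  "partial_y u z = deriv (\<lambda>t::real. u (z + \<i> * of_real t)) 0"

definition C1_on :: "(complex \<Rightarrow> real) \<Rightarrow> complex set \<Rightarrow> bool" where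
  "C1_on u S \<longleftrightarrow> (\<forall>z\<in>S. u differentiable (at z)) \<and>
     continuous_on S (partial_x u) \<and> continuous_on S (partial_y u)"

definition harmonic_on :: "(complex \<Rightarrow> real) \<Rightarrow> complex set \<Rightarrow> bool" where
  "harmonic_on u S \<longleftrightarrow>
     C1_on u S \<and> C1_on (partial_x u) S \<and> C1_on (partial_y u) S \<and>
     (\<forall>z\<in>S. partial_x (partial_x u) z + partial_y (partial_y u) z = 0)"

definition harmonic_mapping :: "(complex \<Rightarrow> complex) \<Rightarrow> bool" where
  "harmonic_mapping f \<longleftrightarrow>
     harmonic_on (\<lambda>z. Re (f z)) unit_disc \<and> harmonic_on (\<lambda>z. Im (f z)) unit_disc"

definition canonical_decomposition ::
  "(complex \<Rightarrow> complex) \<Rightarrow> (complex \<Rightarrow> complex) \<Rightarrow> (complex \<Rightarrow> complex) \<Rightarrow> bool" where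
  "canonical_decomposition f h g \<longleftrightarrow>
     h holomorphic_on unit_disc \<and> g holomorphic_on unit_disc \<and> g 0 = 0 \<and>
     (\<forall>z\<in>unit_disc. f z = h z + cnj (g z))"

definition locally_univalent :: "(complex \<Rightarrow> complex) \<Rightarrow> bool" where
  "locally_univalent f \<longleftrightarrow>
     (\<forall>z\<in>unit_disc. \<exists>U. open U \<and> z \<in> U \<and> U \<subseteq> unit_disc \<and> inj_on f U)"

text \<open>The functions \<open>h\<close> and \<open>g\<close> are determined on the disc by \<open>f\<close>, so carrying them as
  arguments adds no freedom. The last conjunct is positivity of the Jacobian of \<open>f\<close>.\<close>

definition sense_preserving_harmonic_mapping ::
  "(complex \<Rightarrow> complex) \<Rightarrow> (complex \<Rightarrow> complex) \<Rightarrow> (complex \<Rightarrow> complex) \<Rightarrow> bool" where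
  "sense_preserving_harmonic_mapping f h g \<longleftrightarrow>
     harmonic_mapping f \<and> canonical_decomposition f h g \<and> locally_univalent f \<and>
     (\<forall>z\<in>unit_disc. (cmod (deriv h z))\<^sup>2 - (cmod (deriv g z))\<^sup>2 > 0)"

definition subordinate :: "(complex \<Rightarrow> complex) \<Rightarrow> (complex \<Rightarrow> complex) \<Rightarrow> bool" where
  "subordinate h \<phi> \<longleftrightarrow>
     h holomorphic_on unit_disc \<and> \<phi> holomorphic_on unit_disc \<and> h 0 = \<phi> 0 \<and>
     (\<exists>w. w holomorphic_on unit_disc \<and>
          (\<forall>z\<in>unit_disc. cmod (w z) \<le> cmod z \<and> h z = \<phi> (w z)))"

definition convex_univalent :: "(complex \<Rightarrow> complex) \<Rightarrow> bool" where
  "convex_univalent \<phi> \<longleftrightarrow>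
     \<phi> holomorphic_on unit_disc \<and> inj_on \<phi> unit_disc \<and> convex (\<phi> ` unit_disc)"

text \<open>The expansion of \<open>g\<close> starts at \<open>n = 2\<close>, so \<open>b 0\<close> and \<open>b 1\<close> are never used.\<close>

definition bohr_setting ::
  "(complex \<Rightarrow> complex) \<Rightarrow> (complex \<Rightarrow> complex) \<Rightarrow> (complex \<Rightarrow> complex) \<Rightarrow>
   (nat \<Rightarrow> complex) \<Rightarrow> (nat \<Rightarrow> complex) \<Rightarrow> (complex \<Rightarrow> complex) \<Rightarrow> bool" where
  "bohr_setting f h g a b \<phi> \<longleftrightarrow>
     sense_preserving_harmonic_mapping f h g \<and>
     (\<forall>z\<in>unit_disc. (\<lambda>n. a n * z ^ n) sums h z) \<and>
     (\<forall>z\<in>unit_disc. (\<lambda>n. b (n + 2) * z ^ (n + 2)) sums g z) \<and>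
     convex_univalent \<phi> \<and> subordinate h \<phi>"

text \<open>Both series converge for \<open>0 \<le> r < 1\<close> whenever \<open>a\<close> and \<open>b\<close> come from a
  \<open>bohr_setting\<close>, because power series converge absolutely inside the disc.\<close>

definition bohr_sum :: "(nat \<Rightarrow> complex) \<Rightarrow> (nat \<Rightarrow> complex) \<Rightarrow> real \<Rightarrow> real" where
  "bohr_sum a b r =
     (\<Sum>n. cmod (a (n + 1)) * r ^ (n + 1)) + (\<Sum>n. cmod (b (n + 2)) * r ^ (n + 2))"

definition is_rc :: "real \<Rightarrow> bool" where
  "is_rc r \<longleftrightarrow> 0 < r \<and> r < 1 \<and>
     r / (1 - r) + r\<^sup>2 / (1 - r\<^sup>2) * sqrt (((1 + r\<^sup>2) / (1 - r\<^sup>2)) * (pi\<^sup>2 / 6 - 1)) = 1 / 2"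

definition is_R :: "real \<Rightarrow> bool" where
  "is_R r \<longleftrightarrow> 0 < r \<and> r < 1 \<and> 4 * r / (1 - r) + 2 * ln (1 - r) = 1"

end

theory Submission
  imports Defs
begin

text \<open>A supporting half-plane of \<open>\<phi>(D)\<close> at a boundary point nearest to \<open>\<phi>(0)\<close>, which is at
  distance \<open>d\<close>, contains \<open>h(D)\<close>; Caratheodory's inequality for functions of positive real part
  then gives \<open>\<bar>a\<^sub>n\<bar> \<le> 2 d\<close>. Since \<open>b\<^sub>1 = 0\<close>, the dilatation vanishes at 0 and the Schwarz lemma
  gives \<open>\<bar>g'(z)\<bar> \<le> \<bar>z\<bar> \<bar>h'(z)\<bar>\<close>. Taking quadratic means over \<open>\<bar>z\<bar> = r\<close> yields
  \<open>\<Sum> n\<^sup>2 \<bar>b\<^sub>n\<bar>\<^sup>2 r\<^bsup>2n-2\<^esup> \<le> r\<^sup>2 \<Sum> n\<^sup>2 \<bar>a\<^sub>n\<bar>\<^sup>2 r\<^bsup>2n-2\<^esup> \<le> 4 d\<^sup>2 r\<^sup>2 (1 + r\<^sup>2) / (1 - r\<^sup>2)\<^sup>3\<close>, and the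
  Cauchy--Schwarz inequality against \<open>\<Sum>\<^bsub>n\<ge>2\<^esub> 1 / n\<^sup>2 = \<pi>\<^sup>2 / 6 - 1\<close> bounds \<open>\<Sum> \<bar>b\<^sub>n\<bar> r\<^sup>n\<close>.
  Sharpness up to \<open>R\<close> comes from \<open>\<phi>(z) = h(z) = z / (1 - z)\<close>, whose image is the half-plane
  \<open>Re w > -1/2\<close>, with dilatation \<open>z\<close>, that is \<open>g(z) = z / (1 - z) + Log (1 - z)\<close>.\<close>

section \<open>Coefficient inequalities for power series in the disc\<close>

lemma sum_powers_root_of_unity:
  fixes q :: "'a :: field"
  assumes "q ^ N = 1"
  shows "(\<Sum>j<N. q ^ j) = (if q = 1 then of_nat N else 0)"
  using assms by (simp add: sum_gp_strict)

text \<open>A geometric sum in \<open>\<zeta> ^ m\<close>, which is 1 exactly when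
  \<open>N dvd m\<close>. It serves as the filter that keeps only coefficients whose index is a
  multiple of \<open>N\<close>.\<close>

lemma sum_roots_of_unity_powers:
  assumes "N > 0"
  defines "\<zeta> \<equiv> exp (2 * of_real pi * \<i> / of_nat N)"
  shows "(\<Sum>j<N. (\<zeta> ^ j) ^ m) = (if N dvd m then of_nat N else 0)"
proof -
  have \<zeta>_pow: "\<zeta> ^ k = exp (2 * of_real pi * \<i> * of_nat k / of_nat N)" for k
    unfolding \<zeta>_def by (simp add: mult_ac flip: exp_of_nat_mult)
  have "\<zeta> ^ N = 1"
    using \<zeta>_pow[of N] assms complex_root_unity_eq_1[of N N] by simp
  then have "(\<zeta> ^ m) ^ N = 1"
    by (metis mult.commute power_mult power_one)
  then have "(\<Sum>j<N. (\<zeta> ^ m) ^ j) = (if \<zeta> ^ m = 1 then of_nat N else 0)"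
    by (rule sum_powers_root_of_unity)
  moreover have "\<zeta> ^ m = 1 \<longleftrightarrow> N dvd m"
    using \<zeta>_pow complex_root_unity_eq_1[of N m] assms by simp
  moreover have "(\<zeta> ^ j) ^ m = (\<zeta> ^ m) ^ j" for j
    by (metis mult.commute power_mult)
  ultimately show ?thesis by simp
qed

text \<open>Expanding the squares gives a double sum over \<open>m\<close> and \<open>n\<close>, and
  summing over \<open>j\<close> first kills the off-diagonal terms. Exponents below \<open>N\<close>
  give distinct powers of \<open>\<zeta>\<close>, so no two coefficients interfere.\<close>

lemma discrete_parseval:
  fixes c :: "nat \<Rightarrow> complex" and r :: real
  assumes "N > 0"
  defines "\<zeta> \<equiv> exp (2 * of_real pi * \<i> / of_nat N)"
  shows "(\<Sum>j<N. (cmod (\<Sum>n<N. c n * (of_real r * \<zeta> ^ j) ^ n))\<^sup>2) =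
    of_nat N * (\<Sum>n<N. (cmod (c n))\<^sup>2 * r ^ (2 * n))"
proof -
  have \<zeta>_pow: "\<zeta> ^ k = exp (2 * of_real pi * \<i> * of_nat k / of_nat N)" for k
    unfolding \<zeta>_def by (simp add: mult_ac flip: exp_of_nat_mult)
  have norm1: "\<zeta> * cnj \<zeta> = 1"
    by (simp add: \<zeta>_def flip: complex_norm_square)
  have "\<zeta> ^ N = 1"
    using \<zeta>_pow[of N] assms complex_root_unity_eq_1[of N N] by simp
  then have "(\<zeta> ^ N) ^ m * cnj ((\<zeta> ^ N) ^ n) = 1" for m n
    by simp
  then have N1: "(\<zeta> ^ m * cnj \<zeta> ^ n) ^ N = 1" for m n
    by (simp add: power_mult_distrib mult.commute[of _ N] flip: power_mult)
  have eq1: "\<zeta> ^ m * cnj \<zeta> ^ n = 1 \<longleftrightarrow> m = n" if "m < N" "n < N" for m n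
  proof -
    have n1: "\<zeta> ^ n * cnj \<zeta> ^ n = 1" by (simp add: norm1 flip: power_mult_distrib)
    have "\<zeta> ^ m * cnj \<zeta> ^ n = 1 \<longleftrightarrow> \<zeta> ^ m = \<zeta> ^ n"
      using n1 by (metis (no_types, opaque_lifting) mult.assoc mult.commute mult_1)
    also have "\<dots> \<longleftrightarrow> m = n"
      unfolding \<zeta>_pow using complex_root_unity_eq[of N m n] that by simp
    finally show ?thesis .
  qed
  have orth: "(\<Sum>j<N. (\<zeta> ^ m * cnj \<zeta> ^ n) ^ j) = (if m = n then of_nat N else 0)"
    if "m < N" "n < N" for m n
    using sum_powers_root_of_unity[OF N1] eq1[OF that] by simp
  have "of_real (\<Sum>j<N. (cmod (\<Sum>n<N. c n * (of_real r * \<zeta> ^ j) ^ n))\<^sup>2) =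
     (\<Sum>j<N. \<Sum>m<N. \<Sum>n<N. (c m * cnj (c n) * of_real r ^ (m + n)) * (\<zeta> ^ m * cnj \<zeta> ^ n) ^ j)"
    unfolding of_real_sum complex_norm_square cnj_sum sum_product
    by (intro sum.cong refl)
       (simp add: power_mult_distrib power_add mult_ac flip: power_mult)
  also have "\<dots> = (\<Sum>m<N. \<Sum>n<N. \<Sum>j<N. (c m * cnj (c n) * of_real r ^ (m + n)) * (\<zeta> ^ m * cnj \<zeta> ^ n) ^ j)"
    by (subst sum.swap, rule sum.cong[OF refl], rule sum.swap)
  also have "\<dots> = (\<Sum>m<N. \<Sum>n<N. (c m * cnj (c n) * of_real r ^ (m + n)) * (if m = n then of_nat N else 0))"
    by (intro sum.cong refl) (simp add: orth flip: sum_distrib_left)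
  also have "\<dots> = (\<Sum>m<N. c m * cnj (c m) * of_real r ^ (m + m) * of_nat N)"
    by (intro sum.cong refl) (simp add: if_distrib[of "\<lambda>x. _ * x"] cong: if_cong)
  also have "\<dots> = of_real (of_nat N * (\<Sum>n<N. (cmod (c n))\<^sup>2 * r ^ (2 * n)))"
    by (simp add: sum_distrib_left mult_ac mult_2_right power_add flip: complex_norm_square)
  finally show ?thesis by (simp only: of_real_eq_iff)
qed

lemma powser_uniform_on_circle:
  fixes c :: "nat \<Rightarrow> complex"
  assumes f: "\<And>z. z \<in> unit_disc \<Longrightarrow> (\<lambda>n. c n * z ^ n) sums f z"
    and r: "0 \<le> r" "r < 1" and e: "e > 0"
  shows "\<forall>\<^sub>F N in sequentially. \<forall>z. cmod z = r \<longrightarrow> cmod ((\<Sum>n<N. c n * z ^ n) - f z) < e"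
proof -
  \<comment> \<open>Convergence at a point \<open>s\<close> strictly between \<open>r\<close> and 1
    puts the radius of convergence above \<open>r\<close>, hence uniform convergence on
    \<open>cball 0 r\<close>.\<close>
  define s where "s = (r + 1) / 2"
  have s: "0 < s" "s < 1" "r < s" using r by (auto simp: s_def)
  have "summable (\<lambda>n. c n * of_real s ^ n)"
    using f[of "of_real s"] s by (auto intro: sums_summable)
  then have "norm (of_real s :: complex) \<le> conv_radius c"
    by (rule conv_radius_geI)
  then have "ereal r < conv_radius c"
    using s by (metis abs_of_pos ereal_less_eq(3) less_ereal.simps(1) norm_of_real order_less_le_trans)
  then have "uniform_limit (cball 0 r) (\<lambda>N z. \<Sum>n<N. c n * (z - 0) ^ n) (\<lambda>z. suminf (\<lambda>n. c n * (z - 0) ^ n)) sequentially"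
    by (rule powser_uniform_limit)
  from uniform_limitD[OF this e]
  have "\<forall>\<^sub>F N in sequentially. \<forall>z\<in>cball 0 r. dist (\<Sum>n<N. c n * z ^ n) (\<Sum>n. c n * z ^ n) < e" by simp
  then show ?thesis
  proof (rule eventually_mono, safe)
    fix N z assume *: "\<forall>z\<in>cball 0 (cmod z). dist (\<Sum>n<N. c n * z ^ n) (\<Sum>n. c n * z ^ n) < e" and "r = cmod z"
    then show "cmod ((\<Sum>n<N. c n * z ^ n) - f z) < e"
      using f[of z] r sums_unique[of "\<lambda>n. c n * z ^ n" "f z"]
      by (auto simp: dist_norm)
  qed
qed

text \<open>The mean value of \<open>\<bar>p\<bar>\<^sup>2\<close> over \<open>N\<close> equidistant points of the circle is exact for polynomials
  of degree below \<open>N\<close>, so no integration is needed: compare the partial sums there.\<close>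

lemma square_mean_domination:
  fixes A B :: "nat \<Rightarrow> complex"
  assumes F: "\<And>z. z \<in> unit_disc \<Longrightarrow> (\<lambda>n. A n * z ^ n) sums F z"
    and G: "\<And>z. z \<in> unit_disc \<Longrightarrow> (\<lambda>n. B n * z ^ n) sums G z"
    and r: "0 \<le> r" "r < 1" and C: "0 \<le> C"
    and le: "\<And>z. cmod z = r \<Longrightarrow> cmod (G z) \<le> C * cmod (F z)"
    and M: "\<And>N. (\<Sum>n<N. (cmod (A n))\<^sup>2 * r ^ (2 * n)) \<le> M"
  shows "(\<Sum>n<N. (cmod (B n))\<^sup>2 * r ^ (2 * n)) \<le> C\<^sup>2 * M"
proof -
  \<comment> \<open>The hypothesis compares \<open>F\<close> and \<open>G\<close>, whereas the exact
    mean value formula concerns their partial sums. The parameter \<open>\<delta>\<close> absorbs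
    the truncation error and tends to 0 at the end.\<close>
  have "(\<Sum>n<N. (cmod (B n))\<^sup>2 * r ^ (2 * n)) \<le> (1 + \<delta>) * C\<^sup>2 * M + \<delta> + \<delta>\<^sup>2" if \<delta>: "\<delta> > 0" for \<delta>
  proof -
    define e where "e = \<delta> / (1 + C)"
    have e: "e > 0" "(1 + C) * e = \<delta>" using \<delta> C by (auto simp: e_def field_simps)
    have "\<forall>\<^sub>F K in sequentially. (\<forall>z. cmod z = r \<longrightarrow> cmod ((\<Sum>n<K. A n * z ^ n) - F z) < e) \<and>
       (\<forall>z. cmod z = r \<longrightarrow> cmod ((\<Sum>n<K. B n * z ^ n) - G z) < e) \<and> Suc N \<le> K"
      by (intro eventually_conj powser_uniform_on_circle F G r e eventually_ge_at_top)
    then have "\<exists>K. (\<forall>z. cmod z = r \<longrightarrow> cmod ((\<Sum>n<K. A n * z ^ n) - F z) < e) \<and>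
       (\<forall>z. cmod z = r \<longrightarrow> cmod ((\<Sum>n<K. B n * z ^ n) - G z) < e) \<and> Suc N \<le> K"
      by (rule eventually_happens'[OF sequentially_bot])
    then obtain K where K: "\<And>z. cmod z = r \<Longrightarrow> cmod ((\<Sum>n<K. A n * z ^ n) - F z) < e"
       "\<And>z. cmod z = r \<Longrightarrow> cmod ((\<Sum>n<K. B n * z ^ n) - G z) < e" "Suc N \<le> K"
      by blast
    define \<zeta> where "\<zeta> = exp (2 * of_real pi * \<i> / of_nat K)"
    \<comment> \<open>The cross term of \<open>(C * ?a + \<delta>)\<^sup>2\<close> is split by
      \<open>2 * x \<le> x\<^sup>2 + 1\<close>. What remains is affine in \<open>?a\<^sup>2\<close>,
      so it can be averaged over the circle and bounded by \<open>M\<close>.\<close>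
    have pw: "(cmod (\<Sum>n<K. B n * z ^ n))\<^sup>2 \<le> (1 + \<delta>) * C\<^sup>2 * (cmod (\<Sum>n<K. A n * z ^ n))\<^sup>2 + (\<delta> + \<delta>\<^sup>2)"
      if z: "cmod z = r" for z
    proof -
      let ?a = "cmod (\<Sum>n<K. A n * z ^ n)"
      have 1: "cmod (\<Sum>n<K. B n * z ^ n) \<le> cmod (G z) + e"
        using K(2)[OF z] norm_triangle_ineq2[of "\<Sum>n<K. B n * z ^ n" "G z"] by linarith
      have 2: "cmod (F z) \<le> ?a + e"
        using K(1)[OF z] norm_triangle_ineq2[of "F z" "\<Sum>n<K. A n * z ^ n"] norm_minus_commute[of "F z"] by fastforce
      have "cmod (\<Sum>n<K. B n * z ^ n) \<le> C * cmod (F z) + e" using 1 le[OF z] by linarith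
      also have "\<dots> \<le> C * (?a + e) + e" using 2 C by (intro add_mono mult_left_mono) auto
      also have "\<dots> = C * ?a + \<delta>" using e by (simp add: algebra_simps)
      finally have "(cmod (\<Sum>n<K. B n * z ^ n))\<^sup>2 \<le> (C * ?a + \<delta>)\<^sup>2" by (intro power_mono) auto
      also have "\<dots> = (C * ?a)\<^sup>2 + \<delta> * (2 * (C * ?a)) + \<delta>\<^sup>2" by (simp add: power2_eq_square algebra_simps)
      also have "2 * (C * ?a) \<le> (C * ?a)\<^sup>2 + 1"
        using sum_squares_bound[of "C * ?a" 1] by simp
      finally show ?thesis using \<delta> by (simp add: algebra_simps power_mult_distrib)
    qed
    have Kpos: "K > 0" using K by simp
    have circ: "cmod (of_real r * \<zeta> ^ j) = r" for j
      using r by (simp add: \<zeta>_def norm_mult norm_power)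
    have "of_nat K * (\<Sum>n<K. (cmod (B n))\<^sup>2 * r ^ (2 * n)) = (\<Sum>j<K. (cmod (\<Sum>n<K. B n * (of_real r * \<zeta> ^ j) ^ n))\<^sup>2)"
      using discrete_parseval[OF Kpos, of B r] by (simp add: \<zeta>_def)
    also have "\<dots> \<le> (\<Sum>j<K. (1 + \<delta>) * C\<^sup>2 * (cmod (\<Sum>n<K. A n * (of_real r * \<zeta> ^ j) ^ n))\<^sup>2 + (\<delta> + \<delta>\<^sup>2))"
      by (intro sum_mono pw circ)
    also have "\<dots> = (1 + \<delta>) * C\<^sup>2 * (of_nat K * (\<Sum>n<K. (cmod (A n))\<^sup>2 * r ^ (2 * n))) + of_nat K * (\<delta> + \<delta>\<^sup>2)"
      unfolding sum.distrib discrete_parseval[OF Kpos, of A r, symmetric] by (simp add: \<zeta>_def sum_distrib_left distrib_left)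
    also have "\<dots> \<le> (1 + \<delta>) * C\<^sup>2 * (of_nat K * M) + of_nat K * (\<delta> + \<delta>\<^sup>2)"
      using \<delta> by (intro add_mono mult_left_mono M) auto
    also have "\<dots> = of_nat K * ((1 + \<delta>) * C\<^sup>2 * M + \<delta> + \<delta>\<^sup>2)" by (simp add: algebra_simps)
    finally have "(\<Sum>n<K. (cmod (B n))\<^sup>2 * r ^ (2 * n)) \<le> (1 + \<delta>) * C\<^sup>2 * M + \<delta> + \<delta>\<^sup>2"
      using Kpos by simp
    moreover have "(\<Sum>n<N. (cmod (B n))\<^sup>2 * r ^ (2 * n)) \<le> (\<Sum>n<K. (cmod (B n))\<^sup>2 * r ^ (2 * n))"
      using K r by (intro sum_mono2) auto
    ultimately show ?thesis by linarith
  qed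
  then have ev: "\<forall>\<^sub>F \<delta> in at_right 0. (\<Sum>n<N. (cmod (B n))\<^sup>2 * r ^ (2 * n)) \<le> (1 + \<delta>) * C\<^sup>2 * M + \<delta> + \<delta>\<^sup>2"
    by (auto simp: eventually_at_right_less intro: eventually_mono[OF eventually_at_right_less])
  have "((\<lambda>\<delta>. (1 + \<delta>) * C\<^sup>2 * M + \<delta> + \<delta>\<^sup>2) \<longlongrightarrow> (1 + 0) * C\<^sup>2 * M + 0 + 0\<^sup>2) (at_right 0)"
    by (intro tendsto_intros)
  from tendsto_lowerbound[OF this ev] show ?thesis by simp
qed

section \<open>Caratheodory's coefficient inequality\<close>

lemma deriv_at_0_powser:
  fixes c :: "nat \<Rightarrow> complex"
  assumes "\<And>z. z \<in> unit_disc \<Longrightarrow> (\<lambda>n. c n * z ^ n) sums f z"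
  shows "deriv f 0 = c 1"
proof -
  have "(\<lambda>z. suminf (\<lambda>n. c n * z ^ n)) field_differentiable at 0
    \<and> deriv (\<lambda>z. suminf (\<lambda>n. c n * z ^ n)) 0 = (\<Sum>n. diffs c n * 0 ^ n)"
  proof -
    have "((\<lambda>z. \<Sum>n. c n * z ^ n) has_field_derivative (\<Sum>n. diffs c n * 0 ^ n)) (at 0)"
      using assms[of "1/2"] by (intro termdiffs_strong[of c "1/2"]) (auto intro: sums_summable)
    then show ?thesis by (auto simp: DERIV_imp_deriv field_differentiable_def)
  qed
  moreover have "deriv f 0 = deriv (\<lambda>z. suminf (\<lambda>n. c n * z ^ n)) 0"
  proof (rule deriv_cong_ev)
    show "\<forall>\<^sub>F z in nhds 0. f z = suminf (\<lambda>n. c n * z ^ n)"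
      by (rule eventually_nhds_in_open[of unit_disc, THEN eventually_mono])
         (use assms sums_unique in auto)
  qed simp
  ultimately show ?thesis
    by (simp add: powser_zero diffs_def)
qed

text \<open>The Cayley transform \<open>W\<close> carries the right half-plane to the disc and
  \<open>P 0\<close> to 0. The Schwarz lemma bounds its derivative at 0, which is
  \<open>deriv P 0 / (2 * Re (P 0))\<close>.\<close>

lemma caratheodory_first_coefficient:
  assumes P: "P holomorphic_on unit_disc" and pos: "\<And>z. z \<in> unit_disc \<Longrightarrow> Re (P z) > 0"
  shows "cmod (deriv P 0) \<le> 2 * Re (P 0)"
proof -
  define W where "W z = (P z - P 0) / (P z + cnj (P 0))" for z
  have P0: "Re (P 0) > 0" using pos by simp
  have nz: "P z + cnj (P 0) \<noteq> 0" if "z \<in> unit_disc" for z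
  proof
    assume "P z + cnj (P 0) = 0"
    then have "Re (P z) + Re (P 0) = 0" by (metis cnj.sel(1) plus_complex.simps(1) zero_complex.simps(1))
    then show False using pos[OF that] P0 by simp
  qed
  have W: "W holomorphic_on unit_disc"
    unfolding W_def using nz by (intro holomorphic_intros P) auto
  have "cmod (W z) < 1" if "cmod z < 1" for z
  proof -
    have z: "z \<in> unit_disc" using that by simp
    have "(cmod (P z - P 0))\<^sup>2 < (cmod (P z + cnj (P 0)))\<^sup>2"
    proof -
      have "(cmod (P z + cnj (P 0)))\<^sup>2 - (cmod (P z - P 0))\<^sup>2 = 4 * (Re (P z) * Re (P 0))"
        unfolding cmod_power2 by (simp add: power2_eq_square algebra_simps)
      also have "\<dots> > 0" using pos[OF z] P0 by simp
      finally show ?thesis by simp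
    qed
    then have "cmod (P z - P 0) < cmod (P z + cnj (P 0))"
      by (rule power2_less_imp_less) simp
    then show ?thesis using nz[OF z] by (simp add: W_def norm_divide)
  qed
  then have W': "cmod (deriv W 0) \<le> 1"
    by (intro Schwarz_Lemma(2)[OF W, of 0]) (auto simp: W_def)
  have dP: "(P has_field_derivative deriv P 0) (at 0)"
    by (rule holomorphic_derivI[OF P]) auto
  have "(W has_field_derivative (deriv P 0 * (P 0 + cnj (P 0)) - (P 0 - P 0) * deriv P 0)
      / ((P 0 + cnj (P 0)) * (P 0 + cnj (P 0)))) (at 0)"
    unfolding W_def using nz[of 0] by (auto intro!: derivative_eq_intros dP)
  then have "deriv W 0 = deriv P 0 / (P 0 + cnj (P 0))"
    using nz[of 0] by (simp add: DERIV_imp_deriv)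
  also have "P 0 + cnj (P 0) = of_real (2 * Re (P 0))"
    by (simp add: complex_add_cnj)
  finally have "deriv W 0 = deriv P 0 / of_real (2 * Re (P 0))" .
  then have "cmod (deriv W 0) = cmod (deriv P 0) / (2 * Re (P 0))"
    using P0 by (simp add: norm_divide norm_mult)
  then show ?thesis using W' P0 by (simp add: divide_le_eq)
qed

text \<open>Averaging \<open>F\<close> over the rotations by \<open>n\<close>-th roots of unity gives a function \<open>P (z ^ n)\<close>
  whose first coefficient is the \<open>n\<close>-th coefficient of \<open>F\<close>.\<close>

lemma caratheodory_coefficient:
  assumes F: "\<And>z. z \<in> unit_disc \<Longrightarrow> (\<lambda>n. c n * z ^ n) sums F z"
    and pos: "\<And>z. z \<in> unit_disc \<Longrightarrow> Re (F z) > 0" and n: "n > 0"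
  shows "cmod (c n) \<le> 2 * Re (c 0)"
proof -
  define \<zeta> where "\<zeta> = exp (2 * of_real pi * \<i> / of_nat n)"
  \<comment> \<open>Since \<open>P\<close> is given by its series, no analytic branch of the root is
    needed: at each \<open>w\<close> any single \<open>n\<close>-th root shows convergence and
    positivity.\<close>
  define P where "P w = (\<Sum>k. c (n * k) * w ^ k)" for w
  have "\<exists>p. (\<lambda>k. c (n * k) * w ^ k) sums p \<and> Re p > 0" if w: "w \<in> unit_disc" for w
  proof -
    obtain z where z: "z ^ n = w"
      using n by (metis power_0_left exists_complex_root less_numeral_extra(3))
    have zd: "z * \<zeta> ^ j \<in> unit_disc" for j
    proof -
      have "cmod z ^ n < 1" using w z by (auto simp flip: norm_power)
      then have "cmod z < 1" using n by (simp add: power_less_one_iff)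
      then show ?thesis by (simp add: norm_mult norm_power \<zeta>_def)
    qed
    let ?p = "(\<Sum>j<n. F (z * \<zeta> ^ j)) / of_nat n"
    have "(\<lambda>m. (\<Sum>j<n. c m * (z * \<zeta> ^ j) ^ m) / of_nat n) sums ?p"
      by (intro sums_divide sums_sum F zd)
    also have "(\<lambda>m. (\<Sum>j<n. c m * (z * \<zeta> ^ j) ^ m) / of_nat n) = (\<lambda>m. if n dvd m then c m * z ^ m else 0)"
    proof
      fix m
      have "(\<Sum>j<n. c m * (z * \<zeta> ^ j) ^ m) = c m * z ^ m * (\<Sum>j<n. (\<zeta> ^ j) ^ m)"
        by (simp add: power_mult_distrib sum_distrib_left mult_ac)
      also have "\<dots> = c m * z ^ m * (if n dvd m then of_nat n else 0)"
        using sum_roots_of_unity_powers[OF n] by (simp add: \<zeta>_def)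
      finally show "(\<Sum>j<n. c m * (z * \<zeta> ^ j) ^ m) / of_nat n = (if n dvd m then c m * z ^ m else 0)"
        using n by simp
    qed
    finally have "(\<lambda>k. if n dvd n * k then c (n * k) * z ^ (n * k) else 0) sums ?p"
      using n by (subst sums_mono_reindex[of "\<lambda>k. n * k"]) (auto simp: strict_mono_def)
    then have "(\<lambda>k. c (n * k) * w ^ k) sums ?p"
      by (simp add: power_mult z)
    moreover have "(\<Sum>j<n. Re (F (z * \<zeta> ^ j))) > 0"
      using n pos zd by (intro sum_pos) auto
    then have "Re ?p > 0" using n by simp
    ultimately show ?thesis by blast
  qed
  then have P: "(\<lambda>k. c (n * k) * w ^ k) sums P w" "Re (P w) > 0" if "w \<in> unit_disc" for w
    using that unfolding P_def by (metis sums_unique)+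
  have "P holomorphic_on unit_disc"
    by (rule power_series_holomorphic[where a = "\<lambda>k. c (n * k)"]) (use P in auto)
  then have "cmod (deriv P 0) \<le> 2 * Re (P 0)"
    by (rule caratheodory_first_coefficient) (rule P)
  moreover have "deriv P 0 = c n"
    using deriv_at_0_powser[of "\<lambda>k. c (n * k)" P] P by simp
  moreover have "P 0 = c 0" by (simp add: P_def powser_zero)
  ultimately show ?thesis by simp
qed

section \<open>Bounds for two explicit sums\<close>

text \<open>The second summand on the left is the closed form of the tail
  \<open>\<Sum>n\<ge>N. (n + 1)\<^sup>2 x\<^sup>n\<close>, so that the identity goes through by induction on \<open>N\<close>.\<close>

lemma sum_squares_geometric:
  fixes x :: real
  assumes "x \<noteq> 1"
  shows "(\<Sum>n<N. (real n + 1)\<^sup>2 * x ^ n) + x ^ N * ((real N + 1)\<^sup>2 / (1 - x)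
     + 2 * (real N + 1) * x / (1 - x)\<^sup>2 + x * (1 + x) / (1 - x) ^ 3) = (1 + x) / (1 - x) ^ 3"
proof (induction N)
  case 0
  show ?case using assms by (simp add: divide_simps) (simp add: algebra_simps power2_eq_square power3_eq_cube)
next
  case (Suc N)
  define m where "m = real N + 1"
  have "m\<^sup>2 / (1 - x) + 2 * m * x / (1 - x)\<^sup>2 + x * (1 + x) / (1 - x) ^ 3 =
    m\<^sup>2 + x * ((m + 1)\<^sup>2 / (1 - x) + 2 * (m + 1) * x / (1 - x)\<^sup>2 + x * (1 + x) / (1 - x) ^ 3)"
    using assms by (simp add: divide_simps) (simp add: algebra_simps power2_eq_square power3_eq_cube)
  then have "x ^ N * (m\<^sup>2 / (1 - x) + 2 * m * x / (1 - x)\<^sup>2 + x * (1 + x) / (1 - x) ^ 3) =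
    m\<^sup>2 * x ^ N + x ^ Suc N * ((m + 1)\<^sup>2 / (1 - x) + 2 * (m + 1) * x / (1 - x)\<^sup>2 + x * (1 + x) / (1 - x) ^ 3)"
    by (simp add: algebra_simps)
  then show ?case using Suc by (simp add: m_def add_ac)
qed

lemma sum_squares_geometric_le:
  fixes x :: real
  assumes "0 \<le> x" "x < 1"
  shows "(\<Sum>n<N. (real n + 1)\<^sup>2 * x ^ n) \<le> (1 + x) / (1 - x) ^ 3"
proof -
  have "0 \<le> x ^ N * ((real N + 1)\<^sup>2 / (1 - x) + 2 * (real N + 1) * x / (1 - x)\<^sup>2 + x * (1 + x) / (1 - x) ^ 3)"
    using assms by (intro mult_nonneg_nonneg add_nonneg_nonneg divide_nonneg_nonneg) auto
  then show ?thesis using sum_squares_geometric[of x N] assms by linarith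
qed

lemma sum_inverse_squares_le: "(\<Sum>n<N. (1 / (real n + 2))\<^sup>2) \<le> pi\<^sup>2 / 6 - 1"
proof -
  have "(\<Sum>n<Suc N. 1 / (real n + 1)\<^sup>2) \<le> pi\<^sup>2 / 6"
    using inverse_squares_sums sum_le_suminf[of "\<lambda>n. 1 / (real n + 1)\<^sup>2" "{..<Suc N}"]
    by (auto simp: sums_iff add_ac)
  then show ?thesis
    by (subst (asm) sum.lessThan_Suc_shift) (simp add: power_divide add_ac)
qed

section \<open>The upper bound\<close>

text \<open>Otherwise the inverse of \<open>\<phi>\<close> would be a bounded nonconstant entire
  function. This makes the frontier nonempty, so that \<open>infdist\<close> is attained there and
  is not its default value 0.\<close>

lemma convex_univalent_image_not_UNIV:
  assumes "convex_univalent \<phi>"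
  shows "\<phi> ` unit_disc \<noteq> UNIV"
proof
  assume U: "\<phi> ` unit_disc = UNIV"
  from assms have \<phi>: "\<phi> holomorphic_on unit_disc" "inj_on \<phi> unit_disc"
    by (auto simp: convex_univalent_def)
  obtain g where g: "g holomorphic_on (\<phi> ` unit_disc)" "\<And>z. z \<in> unit_disc \<Longrightarrow> g (\<phi> z) = z"
    using holomorphic_has_inverse[OF \<phi>(1) open_ball \<phi>(2)] by metis
  have "range g \<subseteq> unit_disc" using g(2) U by (metis imageE image_subsetI)
  then have "bounded (range g)" using bounded_ball bounded_subset by blast
  then have "g constant_on UNIV" using g(1) U by (intro Liouville_theorem) auto
  then have "g (\<phi> 0) = g (\<phi> (1/2))" by (auto simp: constant_on_def)
  then show False using g(2)[of 0] g(2)[of "1/2"] by simp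
qed

text \<open>A supporting half-plane at the boundary point nearest to \<open>\<phi> 0\<close> turns \<open>h\<close> into a function
  of positive real part.\<close>

lemma subordinate_coefficient_bound:
  assumes cu: "convex_univalent \<phi>" and sub: "subordinate h \<phi>"
    and a: "\<And>z. z \<in> unit_disc \<Longrightarrow> (\<lambda>n. a n * z ^ n) sums h z" and n: "n > 0"
  shows "cmod (a n) \<le> 2 * infdist (\<phi> 0) (frontier (\<phi> ` unit_disc))"
proof -
  define S where "S = \<phi> ` unit_disc"
  from cu have \<phi>: "\<phi> holomorphic_on unit_disc" "inj_on \<phi> unit_disc" and "convex S"
    by (auto simp: convex_univalent_def S_def)
  have "open S" unfolding S_def by (rule open_mapping_thm3[OF \<phi>(1) open_ball \<phi>(2)])
  have "frontier S \<noteq> {}"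
    using convex_univalent_image_not_UNIV[OF cu] by (simp add: frontier_eq_empty S_def)
  then obtain p where p: "p \<in> frontier S" "infdist (\<phi> 0) (frontier S) = dist (\<phi> 0) p"
    by (metis frontier_closed infdist_attains_inf)
  then have "p \<in> closure S" "p \<notin> rel_interior S"
    using \<open>open S\<close> by (auto simp: frontier_def interior_open rel_interior_open)
  \<comment> \<open>The supporting hyperplane is strict on the relative interior, which is the open
    set \<open>S\<close> itself. Strictness yields the positive real part that Caratheodory's
    inequality asks for.\<close>
  then obtain v where v: "v \<noteq> 0" "\<And>y. y \<in> S \<Longrightarrow> v \<bullet> p < v \<bullet> y"
    using supporting_hyperplane_relative_frontier[OF \<open>convex S\<close>] \<open>open S\<close>
    by (metis rel_interior_open)
  have Re_inner: "Re (cnj v * w) = v \<bullet> w" for w by (simp add: inner_complex_def)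
  \<comment> \<open>The coefficients of \<open>cnj v * (h z - p)\<close>: subtracting
    \<open>p\<close> affects only the constant term. The normal \<open>v\<close> is not normalised,
    as \<open>cmod v\<close> cancels at the end.\<close>
  define c where "c n = (if n = 0 then cnj v * (a 0 - p) else cnj v * a n)" for n
  have h_in: "h z \<in> S" if "z \<in> unit_disc" for z
    using sub that unfolding subordinate_def S_def by force
  have a0: "a 0 = \<phi> 0"
    using sub a[of 0] sums_unique[of "\<lambda>n. a n * 0 ^ n" "h 0"] by (auto simp: subordinate_def powser_zero)
  have "(\<lambda>n. c n * z ^ n) sums (cnj v * (h z - p))" if "z \<in> unit_disc" for z
  proof -
    have "(\<lambda>n. cnj v * (a n * z ^ n) - (if n = 0 then cnj v * p else 0)) sums (cnj v * h z - cnj v * p)"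
      by (intro sums_diff sums_mult a that sums_single)
    then show ?thesis
      by (rule back_subst[of "\<lambda>f. f sums _", OF back_subst[of "\<lambda>x. _ sums x"]])
         (auto simp: c_def algebra_simps)
  qed
  moreover have "Re (cnj v * (h z - p)) > 0" if "z \<in> unit_disc" for z
    unfolding Re_inner using v(2)[OF h_in[OF that]] by (simp add: inner_diff_right)
  ultimately have "cmod (c n) \<le> 2 * Re (c 0)"
    by (rule caratheodory_coefficient[OF _ _ n])
  also have "\<dots> \<le> 2 * cmod (c 0)" using complex_Re_le_cmod[of "c 0"] by simp
  finally have "cmod v * cmod (a n) \<le> cmod v * (2 * cmod (\<phi> 0 - p))"
    using n by (simp add: c_def norm_mult a0)
  then have "cmod (a n) \<le> 2 * cmod (\<phi> 0 - p)" using v(1) by simp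
  then show ?thesis using p by (simp add: S_def dist_norm)
qed

text \<open>Positivity of the Jacobian excludes zeros of \<open>deriv h\<close>, so the dilatation
  is a holomorphic map into the disc that fixes 0, and the Schwarz lemma applies.\<close>

lemma dilatation_bound:
  assumes sp: "sense_preserving_harmonic_mapping f h g" and g0: "deriv g 0 = 0" and z: "z \<in> unit_disc"
  shows "cmod (deriv g z) \<le> cmod z * cmod (deriv h z)"
proof -
  from sp have hg: "h holomorphic_on unit_disc" "g holomorphic_on unit_disc"
    and J: "\<And>z. z \<in> unit_disc \<Longrightarrow> (cmod (deriv g z))\<^sup>2 < (cmod (deriv h z))\<^sup>2"
    by (auto simp: sense_preserving_harmonic_mapping_def canonical_decomposition_def)
  have less: "cmod (deriv g z) < cmod (deriv h z)" if "z \<in> unit_disc" for z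
    using J[OF that] by (rule power2_less_imp_less) simp
  then have nz: "deriv h z \<noteq> 0" if "z \<in> unit_disc" for z
    using that by (metis norm_ge_zero norm_zero not_less)
  have "(\<lambda>z. deriv g z / deriv h z) holomorphic_on unit_disc"
    using nz by (intro holomorphic_on_divide holomorphic_deriv hg open_ball)
  then have "cmod (deriv g z / deriv h z) \<le> cmod z"
    using z less nz g0 by (intro Schwarz_Lemma(1)) (auto simp: norm_divide divide_less_eq)
  then show ?thesis using nz[OF z] by (simp add: norm_divide divide_le_eq mult.commute)
qed

text \<open>Stating the bound for partial sums lets it also supply summability in
  \<open>bohr_sum_le\<close>. Both sides are compared after squaring, where Cauchy-Schwarz and the
  mean value estimate act directly.\<close>

lemma co_analytic_sum_le:
  assumes h: "h holomorphic_on unit_disc" and g: "g holomorphic_on unit_disc"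
    and a: "\<And>z. z \<in> unit_disc \<Longrightarrow> (\<lambda>n. a n * z ^ n) sums h z"
    and b: "\<And>z. z \<in> unit_disc \<Longrightarrow> (\<lambda>n. b n * z ^ n) sums g z"
    and le: "\<And>z. z \<in> unit_disc \<Longrightarrow> cmod (deriv g z) \<le> cmod z * cmod (deriv h z)"
    and A: "\<And>n. n > 0 \<Longrightarrow> cmod (a n) \<le> K" and r: "0 \<le> r" "r < 1"
  shows "(\<Sum>n<N. cmod (b (n + 2)) * r ^ (n + 2)) \<le>
    K * (r\<^sup>2 / (1 - r\<^sup>2) * sqrt (((1 + r\<^sup>2) / (1 - r\<^sup>2)) * (pi\<^sup>2 / 6 - 1)))"
proof (rule power2_le_imp_le)
  have r2: "r\<^sup>2 < 1" using r by (simp add: power_less_one_iff)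
  have K: "0 \<le> K" using A[of 1] norm_ge_zero[of "a 1"] by linarith
  have pi6: "0 \<le> pi\<^sup>2 / 6 - 1" using sum_inverse_squares_le[of 0] by simp
  define M where "M = K\<^sup>2 * ((1 + r\<^sup>2) / (1 - r\<^sup>2) ^ 3)"
  have da: "(\<lambda>n. diffs a n * z ^ n) sums deriv h z" if "z \<in> unit_disc" for z
    using that a holomorphic_derivI[OF h open_ball that] by (intro termdiffs_sums_strong[of 1 a h]) auto
  have db: "(\<lambda>n. diffs b n * z ^ n) sums deriv g z" if "z \<in> unit_disc" for z
    using that b holomorphic_derivI[OF g open_ball that] by (intro termdiffs_sums_strong[of 1 b g]) auto
  have M: "(\<Sum>n<N. (cmod (diffs a n))\<^sup>2 * r ^ (2 * n)) \<le> M" for N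
  proof -
    have "(\<Sum>n<N. (cmod (diffs a n))\<^sup>2 * r ^ (2 * n)) \<le> (\<Sum>n<N. K\<^sup>2 * ((real n + 1)\<^sup>2 * (r\<^sup>2) ^ n))"
    proof (rule sum_mono)
      fix n
      have "(cmod (a (Suc n)))\<^sup>2 \<le> K\<^sup>2" using A by (intro power_mono) auto
      then have "(real n + 1)\<^sup>2 * (cmod (a (Suc n)))\<^sup>2 * (r\<^sup>2) ^ n \<le> (real n + 1)\<^sup>2 * K\<^sup>2 * (r\<^sup>2) ^ n"
        by (intro mult_left_mono mult_right_mono) auto
      moreover have "cmod (diffs a n) = real (Suc n) * cmod (a (Suc n))"
        by (simp only: diffs_def norm_mult norm_of_nat)
      then have "(cmod (diffs a n))\<^sup>2 = (real n + 1)\<^sup>2 * (cmod (a (Suc n)))\<^sup>2"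
        by (simp add: power_mult_distrib add.commute)
      ultimately show "(cmod (diffs a n))\<^sup>2 * r ^ (2 * n) \<le> K\<^sup>2 * ((real n + 1)\<^sup>2 * (r\<^sup>2) ^ n)"
        unfolding power_mult by (simp only: mult_ac)
    qed
    also have "\<dots> = K\<^sup>2 * (\<Sum>n<N. (real n + 1)\<^sup>2 * (r\<^sup>2) ^ n)"
      by (rule sum_distrib_left[symmetric])
    also have "\<dots> \<le> M"
      unfolding M_def by (intro mult_left_mono sum_squares_geometric_le) (use r2 in auto)
    finally show ?thesis .
  qed
  have "cmod (diffs b (Suc n)) = (real n + 2) * cmod (b (n + 2))" for n
  proof -
    have "cmod (diffs b (Suc n)) = real (Suc (Suc n)) * cmod (b (Suc (Suc n)))"
      by (simp only: diffs_def norm_mult norm_of_nat)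
    then show ?thesis by simp
  qed
  \<comment> \<open>Each term is split into a term of the series of \<open>deriv g\<close> at
    \<open>r\<close> times \<open>r / (n + 2)\<close>, the two factors for Cauchy-Schwarz.\<close>
  then have "cmod (b (n + 2)) * r ^ (n + 2) = (cmod (diffs b (Suc n)) * r ^ Suc n) * (r * (1 / (real n + 2)))" for n
    by simp
  then have "(\<Sum>n<N. cmod (b (n + 2)) * r ^ (n + 2)) =
     (\<Sum>n<N. (cmod (diffs b (Suc n)) * r ^ Suc n) * (r * (1 / (real n + 2))))"
    by (simp only:)
  then have "(\<Sum>n<N. cmod (b (n + 2)) * r ^ (n + 2))\<^sup>2 \<le>
     (\<Sum>n<N. (cmod (diffs b (Suc n)) * r ^ Suc n)\<^sup>2) * (\<Sum>n<N. (r * (1 / (real n + 2)))\<^sup>2)"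
    by (simp only: Cauchy_Schwarz_ineq_sum)
  also have "\<dots> \<le> (r\<^sup>2 * M) * (r\<^sup>2 * (pi\<^sup>2 / 6 - 1))"
  proof (rule mult_mono)
    \<comment> \<open>Prepending the nonnegative term of index 0 turns the shifted sum into the one
      bounded by \<open>square_mean_domination\<close>. Its constant \<open>C\<close> is
      \<open>r\<close>, because \<open>cmod z = r\<close> on the circle.\<close>
    have "(\<Sum>n<N. (cmod (diffs b (Suc n)) * r ^ Suc n)\<^sup>2) \<le> (\<Sum>n<Suc N. (cmod (diffs b n))\<^sup>2 * r ^ (2 * n))"
      unfolding sum.lessThan_Suc_shift
      by (simp add: power_mult_distrib mult.commute[of 2] flip: power_mult del: power_Suc mult_Suc mult_Suc_right)
    also have "\<dots> \<le> r\<^sup>2 * M"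
      by (rule square_mean_domination[OF da db r r(1) _ M]) (use le r in auto)
    finally show "(\<Sum>n<N. (cmod (diffs b (Suc n)) * r ^ Suc n)\<^sup>2) \<le> r\<^sup>2 * M" .
    show "(\<Sum>n<N. (r * (1 / (real n + 2)))\<^sup>2) \<le> r\<^sup>2 * (pi\<^sup>2 / 6 - 1)"
    proof -
      have "(\<Sum>n<N. (r * (1 / (real n + 2)))\<^sup>2) = r\<^sup>2 * (\<Sum>n<N. (1 / (real n + 2))\<^sup>2)"
        by (simp only: power_mult_distrib sum_distrib_left)
      then show ?thesis using mult_left_mono[OF sum_inverse_squares_le[of N], of "r\<^sup>2"] by simp
    qed
    show "0 \<le> r\<^sup>2 * M" using r2 by (simp add: M_def)
  qed (auto intro: sum_nonneg)
  also have "\<dots> = (K * (r\<^sup>2 / (1 - r\<^sup>2) * sqrt (((1 + r\<^sup>2) / (1 - r\<^sup>2)) * (pi\<^sup>2 / 6 - 1))))\<^sup>2"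
  proof -
    have "0 \<le> ((1 + r\<^sup>2) / (1 - r\<^sup>2)) * (pi\<^sup>2 / 6 - 1)" using pi6 r2 by simp
    then have "(sqrt (((1 + r\<^sup>2) / (1 - r\<^sup>2)) * (pi\<^sup>2 / 6 - 1)))\<^sup>2 = ((1 + r\<^sup>2) / (1 - r\<^sup>2)) * (pi\<^sup>2 / 6 - 1)"
      by simp
    then show ?thesis
      unfolding M_def power_mult_distrib power_divide by (simp add: power2_eq_square power3_eq_cube)
  qed
  finally show "(\<Sum>n<N. cmod (b (n + 2)) * r ^ (n + 2))\<^sup>2 \<le> \<dots>" .
  show "0 \<le> K * (r\<^sup>2 / (1 - r\<^sup>2) * sqrt (((1 + r\<^sup>2) / (1 - r\<^sup>2)) * (pi\<^sup>2 / 6 - 1)))"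
    using K r2 pi6 by simp
qed

lemma bohr_sum_le:
  assumes setting: "bohr_setting f h g a b \<phi>" and r: "0 \<le> r" "r < 1"
  shows "bohr_sum a b r \<le> 2 * infdist (\<phi> 0) (frontier (\<phi> ` unit_disc)) *
    (r / (1 - r) + r\<^sup>2 / (1 - r\<^sup>2) * sqrt (((1 + r\<^sup>2) / (1 - r\<^sup>2)) * (pi\<^sup>2 / 6 - 1)))"
proof -
  define K where "K = 2 * infdist (\<phi> 0) (frontier (\<phi> ` unit_disc))"
  from setting have sp: "sense_preserving_harmonic_mapping f h g"
    and a: "\<And>z. z \<in> unit_disc \<Longrightarrow> (\<lambda>n. a n * z ^ n) sums h z"
    and b: "\<And>z. z \<in> unit_disc \<Longrightarrow> (\<lambda>n. b (n + 2) * z ^ (n + 2)) sums g z"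
    and cu: "convex_univalent \<phi>" and sub: "subordinate h \<phi>"
    by (auto simp: bohr_setting_def)
  from sp have hg: "h holomorphic_on unit_disc" "g holomorphic_on unit_disc"
    by (auto simp: sense_preserving_harmonic_mapping_def canonical_decomposition_def)
  have K: "cmod (a n) \<le> K" if "n > 0" for n
    unfolding K_def by (rule subordinate_coefficient_bound[OF cu sub a that])
  \<comment> \<open>\<open>bohr_setting\<close> leaves \<open>b 0\<close> and \<open>b 1\<close>
    arbitrary; \<open>\<beta>\<close> replaces them by 0 to obtain the full power series of
    \<open>g\<close>, whence \<open>deriv g 0 = 0\<close>.\<close>
  define \<beta> where "\<beta> n = (if n < 2 then 0 else b n)" for n
  have \<beta>: "(\<lambda>n. \<beta> n * z ^ n) sums g z" if "z \<in> unit_disc" for z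
  proof (subst sums_mono_reindex[of "\<lambda>n. n + 2", symmetric])
    show "\<beta> n * z ^ n = 0" if "n \<notin> range (\<lambda>n. n + 2)" for n
    proof -
      have "n < 2"
      proof (rule ccontr)
        assume "\<not> n < 2"
        then have "n = (n - 2) + 2" by simp
        then show False using that by blast
      qed
      then show ?thesis by (simp add: \<beta>_def)
    qed
  qed (use b[OF that] in \<open>auto simp: \<beta>_def strict_mono_def\<close>)
  have "deriv g 0 = 0"
    using deriv_at_0_powser[OF \<beta>] by (simp add: \<beta>_def)
  note le = dilatation_bound[OF sp this]
  define E where "E = K * (r\<^sup>2 / (1 - r\<^sup>2) * sqrt (((1 + r\<^sup>2) / (1 - r\<^sup>2)) * (pi\<^sup>2 / 6 - 1)))"
  have B: "(\<Sum>n<N. cmod (b (n + 2)) * r ^ (n + 2)) \<le> E" for N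
  proof -
    have "(\<Sum>n<N. cmod (\<beta> (n + 2)) * r ^ (n + 2)) \<le> E"
      unfolding E_def by (rule co_analytic_sum_le[OF hg a \<beta> le K r])
    then show ?thesis by (simp add: \<beta>_def)
  qed
  have "summable (\<lambda>n. cmod (b (n + 2)) * r ^ (n + 2))"
    by (rule summableI_nonneg_bounded[OF _ B]) (use r in auto)
  then have "(\<Sum>n. cmod (b (n + 2)) * r ^ (n + 2)) \<le> E"
    by (rule suminf_le_const[OF _ B])
  moreover have "(\<Sum>n. cmod (a (n + 1)) * r ^ (n + 1)) \<le> K * (r / (1 - r))"
  proof -
    have geo: "(\<lambda>n. K * (r * r ^ n)) sums (K * (r * (1 / (1 - r))))"
      using r by (intro sums_mult geometric_sums) auto
    have "cmod (a (n + 1)) * r ^ (n + 1) \<le> K * (r * r ^ n)" for n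
      using mult_right_mono[OF K[of "n + 1"], of "r ^ (n + 1)"] r by simp
    moreover from this have "summable (\<lambda>n. cmod (a (n + 1)) * r ^ (n + 1))"
      using r by (intro summable_comparison_test'[OF sums_summable[OF geo], of 0]) auto
    ultimately show ?thesis
      using suminf_le[OF _ _ sums_summable[OF geo]] sums_unique[OF geo] by simp
  qed
  ultimately have "bohr_sum a b r \<le> K * (r / (1 - r)) + E"
    unfolding bohr_sum_def by linarith
  then show ?thesis by (simp add: K_def E_def algebra_simps)
qed

section \<open>The extremal half-plane mapping\<close>

text \<open>Agreement of \<open>u\<close> with \<open>Re F\<close> is assumed on \<open>S\<close>
  only, so that the lemma can be applied again to the partial derivatives, which are identified only
  there.\<close>

lemma C1_on_Re_holomorphic:
  assumes F: "F holomorphic_on S" and S: "open S" and u: "\<And>z. z \<in> S \<Longrightarrow> u z = Re (F z)"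
  shows "C1_on u S" "\<And>z. z \<in> S \<Longrightarrow> partial_x u z = Re (deriv F z)"
    "\<And>z. z \<in> S \<Longrightarrow> partial_y u z = Re (\<i> * deriv F z)"
proof -
  have du: "(u has_derivative (\<lambda>k. Re (deriv F z * k))) (at z)" if z: "z \<in> S" for z
  proof -
    have "(F has_derivative (*) (deriv F z)) (at z)"
      using holomorphic_derivI[OF F S z] by (simp add: has_field_derivative_def)
    then have "((\<lambda>w. Re (F w)) has_derivative (\<lambda>k. Re (deriv F z * k))) (at z)"
      by (rule has_derivative_Re)
    then show ?thesis
      by (rule has_derivative_transform_within_open[OF _ S z]) (simp add: u)
  qed
  \<comment> \<open>One chain rule for both directions: \<open>c = 1\<close> and
    \<open>c = \<i>\<close>.\<close>
  have dir: "deriv (\<lambda>t::real. u (z + c * of_real t)) 0 = Re (c * deriv F z)" if z: "z \<in> S" for z c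
  proof -
    have "((\<lambda>t::real. z + c * of_real t) has_derivative (\<lambda>t. c * of_real t)) (at 0)"
      by (auto intro!: derivative_eq_intros)
    then have "((\<lambda>t::real. u (z + c * of_real t)) has_derivative (\<lambda>t. Re (deriv F z * (c * of_real t)))) (at 0)"
      by (rule has_derivative_compose) (use du[OF z] in simp)
    moreover have "(\<lambda>t::real. Re (deriv F z * (c * of_real t))) = (*) (Re (c * deriv F z))"
      by (auto simp: algebra_simps)
    ultimately show ?thesis
      by (intro DERIV_imp_deriv) (simp add: has_field_derivative_def)
  qed
  show px: "partial_x u z = Re (deriv F z)" if "z \<in> S" for z
    using dir[OF that, of 1] by (simp add: partial_x_def)
  show py: "partial_y u z = Re (\<i> * deriv F z)" if "z \<in> S" for z
    using dir[OF that, of \<i>] by (simp add: partial_y_def)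
  have dF: "continuous_on S (deriv F)"
    by (intro holomorphic_on_imp_continuous_on holomorphic_deriv F S)
  have "continuous_on S (partial_x u) \<longleftrightarrow> continuous_on S (\<lambda>z. Re (deriv F z))"
    by (rule continuous_on_cong) (auto simp: px)
  moreover have "continuous_on S (partial_y u) \<longleftrightarrow> continuous_on S (\<lambda>z. Re (\<i> * deriv F z))"
    by (rule continuous_on_cong) (simp_all only: py)
  ultimately show "C1_on u S"
    unfolding C1_on_def using du dF by (auto simp: differentiable_def intro!: continuous_intros)
qed

text \<open>Two rounds of the previous lemma turn the second partial derivatives into
  \<open>Re F''\<close> and \<open>Re (\<i> * \<i> * F'')\<close>, which cancel.\<close>

lemma harmonic_on_Re_holomorphic:
  assumes F: "F holomorphic_on S" and S: "open S" and u: "\<And>z. z \<in> S \<Longrightarrow> u z = Re (F z)"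
  shows "harmonic_on u S"
proof -
  note du = C1_on_Re_holomorphic[OF F S u]
  have F': "deriv F holomorphic_on S" by (intro holomorphic_deriv F S)
  then have iF': "(\<lambda>z. \<i> * deriv F z) holomorphic_on S" by (rule holomorphic_on_mult[OF holomorphic_on_const])
  note dux = C1_on_Re_holomorphic[OF F' S du(2)]
  note duy = C1_on_Re_holomorphic[OF iF' S du(3)]
  have "deriv (\<lambda>z. \<i> * deriv F z) z = \<i> * deriv (deriv F) z" if "z \<in> S" for z
    using holomorphic_derivI[OF F' S that] by (intro DERIV_imp_deriv) (auto intro!: derivative_eq_intros)
  then show ?thesis
    unfolding harmonic_on_def using du(1) dux(1,2) duy(1,3) by auto
qed

text \<open>Conjugating \<open>g\<close> leaves its real part alone and negates its imaginary part,
  so both parts of \<open>f\<close> are real parts of holomorphic functions: \<open>h + g\<close>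
  and \<open>- \<i> * (h - g)\<close>.\<close>

lemma harmonic_mapping_canonical:
  assumes "canonical_decomposition f h g"
  shows "harmonic_mapping f"
  unfolding harmonic_mapping_def
proof
  from assms have h: "h holomorphic_on unit_disc" and g: "g holomorphic_on unit_disc"
    and f: "\<And>z. z \<in> unit_disc \<Longrightarrow> f z = h z + cnj (g z)"
    unfolding canonical_decomposition_def by auto
  show "harmonic_on (\<lambda>z. Re (f z)) unit_disc"
    by (rule harmonic_on_Re_holomorphic[of "\<lambda>z. h z + g z"]) (auto intro!: holomorphic_intros h g simp: f)
  show "harmonic_on (\<lambda>z. Im (f z)) unit_disc"
    by (rule harmonic_on_Re_holomorphic[of "\<lambda>z. - \<i> * (h z - g z)"]) (auto intro!: holomorphic_intros h g simp: f)
qed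

section \<open>The half-plane mapping and injectivity of the extremal harmonic mapping\<close>

lemma norm_less_norm_one_plus_iff: "cmod w < cmod (1 + w) \<longleftrightarrow> - (1 / 2) < Re w"
proof -
  have "cmod w < cmod (1 + w) \<longleftrightarrow> (cmod w)\<^sup>2 < (cmod (1 + w))\<^sup>2"
    by (metis norm_ge_zero power2_less_imp_less power_strict_mono zero_less_numeral)
  also have "\<dots> \<longleftrightarrow> - (1 / 2) < Re w"
    unfolding cmod_power2 by (simp add: power2_eq_square algebra_simps) linarith
  finally show ?thesis .
qed

text \<open>The inverse map is \<open>w / (1 + w)\<close>, and it lands in the disc exactly when
  \<open>w\<close> is closer to 0 than to -1.\<close>

lemma half_plane_image: "(\<lambda>z. z / (1 - z)) ` unit_disc = {w. - (1 / 2) < Re w}"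
proof (intro equalityI subsetI)
  fix w assume "w \<in> (\<lambda>z. z / (1 - z)) ` unit_disc"
  then obtain z where z: "cmod z < 1" "w = z / (1 - z)" by auto
  then have "1 - z \<noteq> 0" by auto
  then have "1 + w = 1 / (1 - z)" "w = z * (1 / (1 - z))" using z by (auto simp: field_simps)
  then have "cmod w < cmod (1 + w)"
    using z \<open>1 - z \<noteq> 0\<close> by (simp add: norm_mult norm_divide divide_strict_right_mono)
  then show "w \<in> {w. - (1 / 2) < Re w}" by (simp add: norm_less_norm_one_plus_iff)
next
  fix w assume "w \<in> {w. - (1 / 2) < Re w}"
  then have less: "cmod w < cmod (1 + w)" by (simp add: norm_less_norm_one_plus_iff)
  then have nz: "1 + w \<noteq> 0" by auto
  then have "w = (w / (1 + w)) / (1 - w / (1 + w))" by (simp add: field_simps)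
  moreover have "w / (1 + w) \<in> unit_disc" using less nz by (simp add: norm_divide divide_less_eq)
  ultimately show "w \<in> (\<lambda>z. z / (1 - z)) ` unit_disc" by (rule image_eqI)
qed

lemma inverse_one_minus: "1 / (1 - z) = 1 + z / (1 - z)" if "cmod z < 1" for z
proof -
  have "1 - z \<noteq> 0" using that by auto
  then have "1 + z / (1 - z) = ((1 - z) + z) / (1 - z)"
    by (metis add_divide_distrib divide_self)
  then show ?thesis by simp
qed

lemma Re_inverse_one_minus_gt:
  assumes "cmod z < 1"
  shows "1 / 2 < Re (1 / (1 - z))"
proof -
  have "z / (1 - z) \<in> {w. - (1 / 2) < Re w}"
    unfolding half_plane_image[symmetric] using assms by auto
  then show ?thesis by (simp add: inverse_one_minus[OF assms])
qed

text \<open>On a ray \<open>v = t u\<close> the function \<open>2 Re (1 / v) + ln \<bar>v\<bar>\<close> is strictly monotone while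
  \<open>Re (1 / v) > 1 / 2\<close>.\<close>

lemma ray_injective:
  fixes s t :: real
  assumes "t > 0" "1 / 2 < s" "1 / 2 < t * s" and eq: "ln t = 2 * s * (t - 1)"
  shows "t = 1"
proof (cases t "1 :: real" rule: linorder_cases)
  case less
  \<comment> \<open>The bound \<open>t * s > 1 / 2\<close> would push \<open>ln (1 / t)\<close>
    above \<open>1 / t - 1\<close>. The other case uses \<open>s > 1 / 2\<close> in the same
    way.\<close>
  have "(1 / t - 1) * 1 < (1 / t - 1) * (2 * (t * s))"
    using assms less by (intro mult_strict_left_mono) (auto simp: field_simps)
  also have "\<dots> = - (2 * s * (t - 1))" using assms by (simp add: field_simps)
  also have "\<dots> = ln (1 / t)" using assms by (simp add: ln_div)
  also have "\<dots> \<le> 1 / t - 1" using assms by (intro ln_le_minus_one) auto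
  finally show ?thesis by simp
next
  case greater
  have "(t - 1) * 1 < (t - 1) * (2 * s)" using assms greater by (intro mult_strict_left_mono) auto
  also have "\<dots> = ln t" using eq by simp
  also have "\<dots> \<le> t - 1" using assms by (intro ln_le_minus_one) auto
  finally show ?thesis by simp
qed

text \<open>With \<open>v = 1 - z\<close> the imaginary part of the mapping is minus the argument of
  \<open>v\<close>, so points with equal values lie on one ray from 0. The real part is
  \<open>2 * Re (1 / v) + ln (cmod v) - 2\<close>, and \<open>ray_injective\<close> separates points
  of a ray.\<close>

lemma extremal_inj:
  "inj_on (\<lambda>z. z / (1 - z) + cnj (z / (1 - z) + Ln (1 - z))) unit_disc"
proof (rule inj_onI)
  fix y z assume y: "y \<in> unit_disc" and z: "z \<in> unit_disc"
    and eq: "y / (1 - y) + cnj (y / (1 - y) + Ln (1 - y)) = z / (1 - z) + cnj (z / (1 - z) + Ln (1 - z))"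
  define u v where "u = 1 - y" and "v = 1 - z"
  have uv: "u \<noteq> 0" "v \<noteq> 0" using y z by (auto simp: u_def v_def)
  have "y / (1 - y) = 1 / u - 1" "z / (1 - z) = 1 / v - 1"
    using y z inverse_one_minus by (auto simp: u_def v_def)
  then have eq: "1 / u - 1 + cnj (1 / u - 1 + Ln u) = 1 / v - 1 + cnj (1 / v - 1 + Ln v)"
    using eq by (simp add: u_def v_def)
  have Im_Re: "Im (w + cnj (w + l)) = - Im l" "Re (w + cnj (w + l)) = 2 * Re w + Re l" for w l
    by simp_all
  have Im: "Im (Ln u) = Im (Ln v)" using arg_cong[OF eq, of Im] unfolding Im_Re by simp
  have Re: "2 * Re (1 / u) + ln (cmod u) = 2 * Re (1 / v) + ln (cmod v)"
    using arg_cong[OF eq, of Re] uv unfolding Im_Re by simp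
  \<comment> \<open>The ratio of moduli is the factor along the ray: \<open>v = t * u\<close>. Then
    \<open>Re (1 / u) = t * Re (1 / v)\<close>, and equality of real parts becomes the equation of
    \<open>ray_injective\<close> with \<open>s = Re (1 / v)\<close>.\<close>
  define t where "t = cmod v / cmod u"
  have t: "t > 0" using uv by (simp add: t_def)
  have lnt: "ln t = ln (cmod v) - ln (cmod u)" using uv by (simp add: t_def ln_div)
  have "Ln v - Ln u = of_real (ln t)" using Im uv by (simp add: complex_eq_iff lnt)
  then have "exp (Ln v) = exp (Ln u + of_real (ln t))" by (simp add: algebra_simps)
  then have v: "v = of_real t * u" using uv t by (simp add: exp_add exp_of_real)
  have "1 / u = of_real t * (1 / v)" using uv t by (simp add: v)
  then have Reu: "Re (1 / u) = t * Re (1 / v)" by (simp only: Re_complex_of_real times_complex.simps Im_complex_of_real)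
  have "t = 1"
  proof (rule ray_injective[OF t])
    show "1 / 2 < Re (1 / v)" using Re_inverse_one_minus_gt[of z] z by (simp add: v_def)
    show "1 / 2 < t * Re (1 / v)"
      using Re_inverse_one_minus_gt[of y] y Reu by (simp add: u_def)
    show "ln t = 2 * Re (1 / v) * (t - 1)"
      using Re Reu lnt by (simp add: algebra_simps)
  qed
  then show "y = z" using v by (simp add: u_def v_def)
qed

section \<open>Power series, hypotheses and Bohr sum of the extremal mapping\<close>

lemma extremal_analytic_sums:
  fixes z :: complex
  assumes "cmod z < 1"
  shows "(\<lambda>n. (if n = 0 then 0 else 1) * z ^ n) sums (z / (1 - z))"
proof -
  have "(\<lambda>n. z ^ n - (if n = 0 then 1 else 0)) sums (1 / (1 - z) - 1)"
    by (intro sums_diff geometric_sums assms sums_single)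
  moreover have "(\<lambda>n. z ^ n - (if n = 0 then 1 else 0)) = (\<lambda>n. (if n = 0 then 0 else 1) * z ^ n)"
    by auto
  moreover have "1 / (1 - z) - 1 = z / (1 - z)" using inverse_one_minus[OF assms] by simp
  ultimately show ?thesis by simp
qed

text \<open>The coefficients are \<open>1 - 1 / n\<close> for \<open>n \<ge> 2\<close>: a geometric
  series combined with the tail of the logarithmic series.\<close>

lemma extremal_co_analytic_sums:
  assumes "cmod z < 1"
  shows "(\<lambda>n. of_nat (n + 2 - 1) / of_nat (n + 2) * z ^ (n + 2)) sums (z / (1 - z) + Ln (1 - z))"
proof -
  have "(\<lambda>n. - (z ^ n) / of_nat n) sums Ln (1 - z)"
    using Ln_series'[of "- z"] assms by simp
  \<comment> \<open>The term of index 0 vanishes because division by 0 gives 0; the term of index 1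
    is \<open>- z\<close>.\<close>
  from sums_split_initial_segment[OF this, of 2]
  have "(\<lambda>n. - (z ^ (n + 2)) / of_nat (n + 2)) sums (Ln (1 - z) + z)"
    by (simp add: eval_nat_numeral)
  moreover have "(\<lambda>n. z\<^sup>2 * z ^ n) sums (z\<^sup>2 * (1 / (1 - z)))"
    by (intro sums_mult geometric_sums assms)
  ultimately have "(\<lambda>n. z\<^sup>2 * z ^ n + - (z ^ (n + 2)) / of_nat (n + 2)) sums (z\<^sup>2 * (1 / (1 - z)) + (Ln (1 - z) + z))"
    by (intro sums_add)
  moreover have "z\<^sup>2 * z ^ n + - (z ^ (n + 2)) / of_nat (n + 2) = of_nat (n + 2 - 1) / of_nat (n + 2) * z ^ (n + 2)" for n
  proof -
    have "z\<^sup>2 * z ^ n + - (z ^ (n + 2)) / N = (N - 1) / N * z ^ (n + 2)" if "N \<noteq> 0" for N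
      using that by (simp add: field_simps power2_eq_square)
    moreover have "(of_nat (n + 2) :: complex) \<noteq> 0" by (simp only: of_nat_eq_0_iff)
    moreover have "(of_nat (n + 2 - 1) :: complex) = of_nat (n + 2) - 1" by simp
    ultimately show ?thesis by metis
  qed
  moreover have "z\<^sup>2 * (1 / (1 - z)) + (Ln (1 - z) + z) = z / (1 - z) + Ln (1 - z)"
  proof -
    have "z\<^sup>2 * (1 / (1 - z)) = z * (z / (1 - z))" by (simp add: power2_eq_square)
    also have "\<dots> = z / (1 - z) - z"
      using inverse_one_minus[OF assms] by (metis (no_types, opaque_lifting) add_diff_cancel_left' mult.commute mult_1 right_diff_distrib times_divide_eq_left times_divide_eq_right)
    finally show ?thesis by simp
  qed
  ultimately show ?thesis by (simp only:)
qed

lemma extremal_bohr_setting: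
  defines "h \<equiv> \<lambda>z::complex. z / (1 - z)" and "g \<equiv> \<lambda>z. z / (1 - z) + Ln (1 - z)"
  shows "bohr_setting (\<lambda>z. h z + cnj (g z)) h g (\<lambda>n. if n = 0 then 0 else 1)
    (\<lambda>n. of_nat (n - 1) / of_nat n) h"
proof -
  have nz: "1 - z \<noteq> 0" if "z \<in> unit_disc" for z :: complex using that by auto
  have slit: "1 - z \<notin> \<real>\<^sub>\<le>\<^sub>0" if "z \<in> unit_disc" for z :: complex
    using that complex_Re_le_cmod[of z] by (auto simp: complex_nonpos_Reals_iff)
  have h: "h holomorphic_on unit_disc"
    unfolding h_def using nz by (intro holomorphic_intros) auto
  have g: "g holomorphic_on unit_disc"
    unfolding g_def using nz slit by (intro holomorphic_intros) auto
  have cd: "canonical_decomposition (\<lambda>z. h z + cnj (g z)) h g"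
    using h g by (simp add: canonical_decomposition_def g_def)
  have inj: "inj_on (\<lambda>z. h z + cnj (g z)) unit_disc"
    using extremal_inj by (simp add: h_def g_def)
  have J: "(cmod (deriv h z))\<^sup>2 - (cmod (deriv g z))\<^sup>2 > 0" if z: "z \<in> unit_disc" for z
  proof -
    have dh: "deriv h z = 1 / (1 - z)\<^sup>2" unfolding h_def
      by (rule DERIV_imp_deriv) (use nz[OF z] in \<open>auto intro!: derivative_eq_intros simp: power2_eq_square\<close>)
    have "(g has_field_derivative 1 / (1 - z)\<^sup>2 - 1 / (1 - z)) (at z)" unfolding g_def
      using nz[OF z] slit[OF z] by (auto intro!: derivative_eq_intros simp: power2_eq_square inverse_eq_divide)
    \<comment> \<open>With \<open>w = 1 - z\<close> this shows
      \<open>deriv g z = z * deriv h z\<close>: the dilatation is \<open>z\<close>.\<close>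
    moreover have "1 / w\<^sup>2 - 1 / w = (1 - w) / w\<^sup>2" if "w \<noteq> 0" for w :: complex
      using that by (simp add: field_simps power2_eq_square)
    ultimately have dg: "deriv g z = z / (1 - z)\<^sup>2"
      using nz[OF z] by (simp add: DERIV_imp_deriv)
    have "cmod z / (cmod (1 - z))\<^sup>2 < 1 / (cmod (1 - z))\<^sup>2"
      using nz[OF z] z by (intro divide_strict_right_mono) auto
    then have "(cmod z / (cmod (1 - z))\<^sup>2)\<^sup>2 < (1 / (cmod (1 - z))\<^sup>2)\<^sup>2"
      by (intro power_strict_mono) auto
    then show ?thesis by (simp add: dh dg norm_divide norm_power)
  qed
  have sp: "sense_preserving_harmonic_mapping (\<lambda>z. h z + cnj (g z)) h g"
    unfolding sense_preserving_harmonic_mapping_def locally_univalent_def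
    using harmonic_mapping_canonical[OF cd] cd inj J open_ball by blast
  have "inj_on h unit_disc"
    unfolding h_def using nz by (intro inj_onI) (simp add: field_simps)
  moreover have "convex (h ` unit_disc)"
    unfolding h_def half_plane_image by (rule convex_halfspace_Re_gt)
  ultimately have cu: "convex_univalent h" using h by (simp add: convex_univalent_def)
  have sub: "subordinate h h"
    unfolding subordinate_def using h by (auto intro!: exI[of _ "\<lambda>z. z"] holomorphic_intros)
  show ?thesis
    unfolding bohr_setting_def
    using sp cu sub extremal_analytic_sums extremal_co_analytic_sums by (simp add: h_def g_def)
qed

text \<open>All coefficients involved are nonnegative reals, so the Bohr sum at \<open>r\<close> is
  \<open>h r + g r\<close> for the extremal pair.\<close>

lemma extremal_bohr_sum:
  assumes "0 \<le> r" "r < 1"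
  shows "bohr_sum (\<lambda>n. if n = 0 then 0 else 1) (\<lambda>n. of_nat (n - 1) / of_nat n) r =
    2 * r / (1 - r) + ln (1 - r)"
proof -
  have r: "cmod (of_real r) < 1" using assms by simp
  have "(\<lambda>n. complex_of_real (r ^ (n + 1))) sums of_real (r / (1 - r))"
    using sums_split_initial_segment[OF extremal_analytic_sums[OF r], of 1] by simp
  then have 1: "(\<lambda>n. r ^ (n + 1)) sums (r / (1 - r))" by (simp only: sums_of_real_iff)
  have "Ln (1 - of_real r) = of_real (ln (1 - r))"
    using assms by (simp flip: Ln_of_real)
  then have "(\<lambda>n. complex_of_real (real (n + 2 - 1) / real (n + 2) * r ^ (n + 2))) sums of_real (r / (1 - r) + ln (1 - r))"
    using extremal_co_analytic_sums[OF r] by simp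
  then have 2: "(\<lambda>n. real (n + 2 - 1) / real (n + 2) * r ^ (n + 2)) sums (r / (1 - r) + ln (1 - r))"
    by (simp only: sums_of_real_iff)
  have "cmod (of_nat (n + 2 - 1) / of_nat (n + 2)) = real (n + 2 - 1) / real (n + 2)" for n
    by (simp only: norm_divide norm_of_nat)
  then have "bohr_sum (\<lambda>n. if n = 0 then 0 else 1) (\<lambda>n. of_nat (n - 1) / of_nat n) r =
    r / (1 - r) + (r / (1 - r) + ln (1 - r))"
    unfolding bohr_sum_def using sums_unique[OF 1] sums_unique[OF 2] by simp
  then show ?thesis by simp
qed

text \<open>The boundary point -1/2 is the witness; an upper bound on the distance is what refuting
  the Bohr inequality calls for.\<close>

lemma extremal_distance_le:
  defines "\<phi> \<equiv> \<lambda>z::complex. z / (1 - z)"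
  shows "infdist (\<phi> 0) (frontier (\<phi> ` unit_disc)) \<le> 1 / 2"
proof -
  have "frontier {w::complex. 1 \<bullet> w > - (1 / 2)} = {w. 1 \<bullet> w = - (1 / 2)}"
    by (rule frontier_halfspace_gt) simp
  then have "of_real (- (1 / 2)) \<in> frontier (\<phi> ` unit_disc)"
    by (simp add: \<phi>_def half_plane_image inner_complex_def)
  then have "infdist (\<phi> 0) (frontier (\<phi> ` unit_disc)) \<le> dist (\<phi> 0) (of_real (- (1 / 2)))"
    by (rule infdist_le)
  also have "\<dots> = 1 / 2" by (simp add: \<phi>_def dist_norm norm_divide)
  finally show ?thesis .
qed

section \<open>The two radii\<close>

text \<open>Strictness comes from the first summand, while the second is a product of nonnegative
  nondecreasing factors. This gives uniqueness of the root and carries the estimate from the root to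
  smaller radii.\<close>

lemma bohr_equation_mono:
  fixes x y :: real
  assumes "0 \<le> x" "x < y" "y < 1"
  shows "x / (1 - x) + x\<^sup>2 / (1 - x\<^sup>2) * sqrt (((1 + x\<^sup>2) / (1 - x\<^sup>2)) * (pi\<^sup>2 / 6 - 1)) <
         y / (1 - y) + y\<^sup>2 / (1 - y\<^sup>2) * sqrt (((1 + y\<^sup>2) / (1 - y\<^sup>2)) * (pi\<^sup>2 / 6 - 1))"
proof -
  have sq: "x\<^sup>2 \<le> y\<^sup>2" "y\<^sup>2 < 1" "x\<^sup>2 \<le> 1" using assms by (auto intro: power_mono simp: power_less_one_iff power_le_one)
  have "3\<^sup>2 \<le> pi\<^sup>2" using pi_gt3 by (intro power_mono) auto
  then have pi6: "0 \<le> pi\<^sup>2 / 6 - 1" by simp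
  have "x / (1 - x) < y / (1 - y)" using assms by (simp add: field_simps)
  moreover have "x\<^sup>2 / (1 - x\<^sup>2) \<le> y\<^sup>2 / (1 - y\<^sup>2)"
    using sq assms by (intro frac_le) auto
  moreover have "sqrt (((1 + x\<^sup>2) / (1 - x\<^sup>2)) * (pi\<^sup>2 / 6 - 1)) \<le> sqrt (((1 + y\<^sup>2) / (1 - y\<^sup>2)) * (pi\<^sup>2 / 6 - 1))"
    using sq pi6 by (intro real_sqrt_le_mono mult_right_mono frac_le) auto
  ultimately show ?thesis
    using sq assms pi6
    by (intro add_less_le_mono mult_mono) (auto intro!: divide_nonneg_nonneg mult_nonneg_nonneg)
qed

text \<open>The drop of \<open>ln (1 - x)\<close> is at most the growth of
  \<open>x / (1 - x)\<close>, so the factor 4 outweighs the factor 2.\<close>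

lemma R_equation_mono:
  fixes x y :: real
  assumes "0 \<le> x" "x < y" "y < 1"
  shows "4 * x / (1 - x) + 2 * ln (1 - x) < 4 * y / (1 - y) + 2 * ln (1 - y)"
proof -
  have "ln (1 - x) - ln (1 - y) = ln ((1 - x) / (1 - y))" using assms by (simp add: ln_div)
  also have "\<dots> \<le> (1 - x) / (1 - y) - 1" using assms by (intro ln_le_minus_one) auto
  also have "\<dots> = (y - x) / (1 - y)" using assms by (simp add: field_simps)
  also have "\<dots> \<le> (y - x) / ((1 - y) * (1 - x))" 
    using assms by (intro divide_left_mono) (auto simp: mult_le_cancel_left1)
  also have "\<dots> = y / (1 - y) - x / (1 - x)" using assms by (simp add: field_simps)
  finally have "ln (1 - x) - ln (1 - y) \<le> y / (1 - y) - x / (1 - x)" .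
  moreover have "x / (1 - x) < y / (1 - y)" using assms by (simp add: field_simps)
  ultimately show ?thesis by simp
qed

section \<open>Rational bounds that locate the roots to six decimals\<close>

lemma pi_sq_bounds: "0.644934066 \<le> pi\<^sup>2 / 6 - 1" "pi\<^sup>2 / 6 - 1 \<le> 0.644934067"
proof -
  have "3.141592653588\<^sup>2 \<le> pi\<^sup>2" using pi_approx by (intro power_mono) auto
  then show "0.644934066 \<le> pi\<^sup>2 / 6 - 1" by (simp add: power2_eq_square)
  have "pi\<^sup>2 \<le> 3.1415926535899\<^sup>2" using pi_approx by (intro power_mono) auto
  then show "pi\<^sup>2 / 6 - 1 \<le> 0.644934067" by (simp add: power2_eq_square)
qed

text \<open>A rational bound on the square root, checked by squaring, leaves only rational
  arithmetic.\<close>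

lemma rc_equation_lower:
  defines "r \<equiv> 0.294265 :: real"
  shows "r / (1 - r) + r\<^sup>2 / (1 - r\<^sup>2) * sqrt (((1 + r\<^sup>2) / (1 - r\<^sup>2)) * (pi\<^sup>2 / 6 - 1)) \<le> 1 / 2"
proof -
  have "sqrt (((1 + r\<^sup>2) / (1 - r\<^sup>2)) * (pi\<^sup>2 / 6 - 1)) \<le> 0.8759081"
  proof (rule real_le_lsqrt)
    have "((1 + r\<^sup>2) / (1 - r\<^sup>2)) * (pi\<^sup>2 / 6 - 1) \<le> ((1 + r\<^sup>2) / (1 - r\<^sup>2)) * 0.644934067"
      by (rule mult_left_mono[OF pi_sq_bounds(2)]) (simp add: r_def power2_eq_square)
    also have "\<dots> \<le> 0.8759081\<^sup>2" by (simp add: r_def power2_eq_square)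
    finally show "((1 + r\<^sup>2) / (1 - r\<^sup>2)) * (pi\<^sup>2 / 6 - 1) \<le> 0.8759081\<^sup>2" .
  qed simp
  then have "r\<^sup>2 / (1 - r\<^sup>2) * sqrt (((1 + r\<^sup>2) / (1 - r\<^sup>2)) * (pi\<^sup>2 / 6 - 1)) \<le> r\<^sup>2 / (1 - r\<^sup>2) * 0.8759081"
    by (rule mult_left_mono) (simp add: r_def power2_eq_square)
  also have "\<dots> \<le> 1 / 2 - r / (1 - r)" by (simp add: r_def power2_eq_square)
  finally show ?thesis by linarith
qed

lemma rc_equation_upper:
  defines "r \<equiv> 0.294266 :: real"
  shows "1 / 2 < r / (1 - r) + r\<^sup>2 / (1 - r\<^sup>2) * sqrt (((1 + r\<^sup>2) / (1 - r\<^sup>2)) * (pi\<^sup>2 / 6 - 1))"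
proof -
  have "0.8759082 \<le> sqrt (((1 + r\<^sup>2) / (1 - r\<^sup>2)) * (pi\<^sup>2 / 6 - 1))"
  proof (rule real_le_rsqrt)
    have "0.8759082\<^sup>2 \<le> ((1 + r\<^sup>2) / (1 - r\<^sup>2)) * 0.644934066" by (simp add: r_def power2_eq_square)
    also have "\<dots> \<le> ((1 + r\<^sup>2) / (1 - r\<^sup>2)) * (pi\<^sup>2 / 6 - 1)"
      by (rule mult_left_mono[OF pi_sq_bounds(1)]) (simp add: r_def power2_eq_square)
    finally show "0.8759082\<^sup>2 \<le> ((1 + r\<^sup>2) / (1 - r\<^sup>2)) * (pi\<^sup>2 / 6 - 1)" .
  qed
  then have "r\<^sup>2 / (1 - r\<^sup>2) * 0.8759082 \<le> r\<^sup>2 / (1 - r\<^sup>2) * sqrt (((1 + r\<^sup>2) / (1 - r\<^sup>2)) * (pi\<^sup>2 / 6 - 1))"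
    by (rule mult_left_mono) (simp add: r_def power2_eq_square)
  moreover have "1 / 2 - r / (1 - r) < r\<^sup>2 / (1 - r\<^sup>2) * 0.8759082" by (simp add: r_def power2_eq_square)
  ultimately show ?thesis by linarith
qed

lemma R_equation_lower:
  defines "r \<equiv> 0.299823 :: real"
  shows "4 * r / (1 - r) + 2 * ln (1 - r) \<le> 1"
proof -
  \<comment> \<open>Passing to the reciprocal makes the argument of the logarithm exceed 1 before
    \<open>ln_approx_bounds\<close> is applied with four terms.\<close>
  have "ln (1 - r) = - ln (1 / (1 - r))" by (simp add: r_def ln_div)
  moreover have "ln (1 / (1 - r)) \<ge> 0.3564218"
    using ln_approx_bounds[of "1 / (1 - r)" 4]
    by (simp add: r_def eval_nat_numeral)
  moreover have "4 * r / (1 - r) \<le> 1 + 2 * 0.3564218" by (simp add: r_def)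
  ultimately show ?thesis by linarith
qed

lemma R_equation_upper:
  defines "r \<equiv> 0.299824 :: real"
  shows "1 < 4 * r / (1 - r) + 2 * ln (1 - r)"
proof -
  have "ln (1 - r) = - ln (1 / (1 - r))" by (simp add: r_def ln_div)
  moreover have "ln (1 / (1 - r)) \<le> 0.3564238"
    using ln_approx_bounds[of "1 / (1 - r)" 4]
    by (simp add: r_def eval_nat_numeral)
  moreover have "1 + 2 * 0.3564238 < 4 * r / (1 - r)" by (simp add: r_def)
  ultimately show ?thesis by linarith
qed

lemma rc_exists: "\<exists>r. is_rc r \<and> 0.294265 \<le> r \<and> r < 0.294266"
proof -
  let ?\<Phi> = "\<lambda>r::real. r / (1 - r) + r\<^sup>2 / (1 - r\<^sup>2) * sqrt (((1 + r\<^sup>2) / (1 - r\<^sup>2)) * (pi\<^sup>2 / 6 - 1))"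
  have nz: "1 - r\<^sup>2 \<noteq> 0" if "r \<in> {0.294265..0.294266}" for r :: real
    using that power2_eq_1_iff[of r] by auto
  have "continuous_on {0.294265..0.294266} ?\<Phi>"
    using nz by (intro continuous_intros) auto
  then obtain r where r: "0.294265 \<le> r" "r \<le> 0.294266" "?\<Phi> r = 1 / 2"
    using IVT'[of ?\<Phi> "0.294265" "1/2" "0.294266"] rc_equation_lower less_imp_le[OF rc_equation_upper] by auto
  \<comment> \<open>The intermediate value theorem allows the right endpoint; the strict inequality
    there rules it out and fixes the sixth decimal.\<close>
  moreover have "r \<noteq> 0.294266" using r(3) rc_equation_upper by (metis less_irrefl)
  ultimately show ?thesis unfolding is_rc_def by (intro exI[of _ r]) auto
qed

lemma R_exists: "\<exists>r. is_R r \<and> 0.299823 \<le> r \<and> r < 0.299824"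
proof -
  let ?\<Psi> = "\<lambda>r::real. 4 * r / (1 - r) + 2 * ln (1 - r)"
  have "continuous_on {0.299823..0.299824} ?\<Psi>"
    by (intro continuous_intros) auto
  then obtain r where r: "0.299823 \<le> r" "r \<le> 0.299824" "?\<Psi> r = 1"
    using IVT'[of ?\<Psi> "0.299823" "1" "0.299824"] R_equation_lower less_imp_le[OF R_equation_upper] by auto
  moreover have "r \<noteq> 0.299824" using r(3) R_equation_upper by (metis less_irrefl)
  ultimately show ?thesis unfolding is_R_def by (intro exI[of _ r]) auto
qed

lemma is_rc_unique:
  assumes "is_rc x" "is_rc y"
  shows "x = y"
  using assms bohr_equation_mono[of x y] bohr_equation_mono[of y x]
  unfolding is_rc_def by (metis less_imp_le linorder_neqE_linordered_idom order_less_irrefl)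

lemma is_R_unique:
  assumes "is_R x" "is_R y"
  shows "x = y"
  using assms R_equation_mono[of x y] R_equation_mono[of y x]
  unfolding is_R_def by (metis less_imp_le linorder_neqE_linordered_idom order_less_irrefl)

theorem corollary3:
  "\<exists>r\<^sub>c R :: real.
     is_rc r\<^sub>c \<and> (\<forall>r. is_rc r \<longrightarrow> r = r\<^sub>c) \<and> 0.294265 \<le> r\<^sub>c \<and> r\<^sub>c < 0.294266 \<and>
     is_R R \<and> (\<forall>r. is_R r \<longrightarrow> r = R) \<and> 0.299823 \<le> R \<and> R < 0.299824 \<and>
     (\<forall>f h g a b \<phi>. bohr_setting f h g a b \<phi> \<longrightarrow>
        (\<forall>r. 0 \<le> r \<and> r \<le> r\<^sub>c \<longrightarrow>
           bohr_sum a b r \<le> infdist (\<phi> 0) (frontier (\<phi> ` unit_disc)))) \<and>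
     (\<forall>\<rho>. R < \<rho> \<and> \<rho> < 1 \<longrightarrow>
        (\<exists>f h g a b \<phi>. bohr_setting f h g a b \<phi> \<and>
           (\<exists>r. 0 \<le> r \<and> r \<le> \<rho> \<and>
              \<not> bohr_sum a b r \<le> infdist (\<phi> 0) (frontier (\<phi> ` unit_disc)))))"
proof -
  obtain r\<^sub>c where rc: "is_rc r\<^sub>c" "0.294265 \<le> r\<^sub>c" "r\<^sub>c < 0.294266" using rc_exists by blast
  obtain R where R: "is_R R" "0.299823 \<le> R" "R < 0.299824" using R_exists by blast
  have upper: "bohr_sum a b r \<le> infdist (\<phi> 0) (frontier (\<phi> ` unit_disc))"
    if "bohr_setting f h g a b \<phi>" "0 \<le> r" "r \<le> r\<^sub>c" for f h g a b \<phi> r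
  proof -
    have "bohr_sum a b r \<le> 2 * infdist (\<phi> 0) (frontier (\<phi> ` unit_disc)) *
      (r / (1 - r) + r\<^sup>2 / (1 - r\<^sup>2) * sqrt (((1 + r\<^sup>2) / (1 - r\<^sup>2)) * (pi\<^sup>2 / 6 - 1)))"
      using that rc by (intro bohr_sum_le) auto
    \<comment> \<open>The bracket equals 1/2 at \<open>r\<^sub>c\<close> and is smaller below it,
      which cancels the factor 2.\<close>
    also have "\<dots> \<le> 2 * infdist (\<phi> 0) (frontier (\<phi> ` unit_disc)) * (1 / 2)"
    proof (rule mult_left_mono)
      show "r / (1 - r) + r\<^sup>2 / (1 - r\<^sup>2) * sqrt (((1 + r\<^sup>2) / (1 - r\<^sup>2)) * (pi\<^sup>2 / 6 - 1)) \<le> 1 / 2"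
        using that rc(1) bohr_equation_mono[of r r\<^sub>c] unfolding is_rc_def
        by (metis less_eq_real_def)
    qed (simp add: infdist_nonneg)
    finally show ?thesis by simp
  qed
  have lower: "\<exists>f h g a b \<phi>. bohr_setting f h g a b \<phi> \<and>
           (\<exists>r. 0 \<le> r \<and> r \<le> \<rho> \<and> \<not> bohr_sum a b r \<le> infdist (\<phi> 0) (frontier (\<phi> ` unit_disc)))"
    if "R < \<rho>" "\<rho> < 1" for \<rho>
  proof -
    have "1 < 4 * \<rho> / (1 - \<rho>) + 2 * ln (1 - \<rho>)"
      using R that R_equation_mono[of R \<rho>] by (simp add: is_R_def)
    \<comment> \<open>One extremal mapping serves every \<open>\<rho>\<close>, with
      \<open>r = \<rho>\<close> as the failing radius. Its Bohr sum is half the left side of the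
      equation for \<open>R\<close>, so it exceeds 1/2 beyond \<open>R\<close>.\<close>
    then have "1 / 2 < bohr_sum (\<lambda>n. if n = 0 then 0 else 1) (\<lambda>n. of_nat (n - 1) / of_nat n) \<rho>"
      using extremal_bohr_sum[of \<rho>] R that by simp
    then have "\<not> bohr_sum (\<lambda>n. if n = 0 then 0 else 1) (\<lambda>n. of_nat (n - 1) / of_nat n) \<rho> \<le>
       infdist ((\<lambda>z::complex. z / (1 - z)) 0) (frontier ((\<lambda>z. z / (1 - z)) ` unit_disc))"
      using extremal_distance_le by simp
    moreover have "0 \<le> \<rho>" using R that by simp
    ultimately show ?thesis using extremal_bohr_setting by blast
  qed
  show ?thesis
    using rc R upper lower is_rc_unique is_R_unique by (intro exI[of _ r\<^sub>c] exI[of _ R]) blast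
qed

end
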